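(* Let $L$ be a superfield and $K$ a subsuperring of $L$. Then $ZR(L,K)$ is homeomorphic to $ZR(\overline L,\overline K)$.
   Context: A superring is a $\mathbb Z/2$-graded unital ring $R=R_{\overline 0}\oplus R_{\overline 1}$ with $1\neq 0$, assumed supercommutative: $R_{\overline 0}$ is central in $R$ and every element of $R_{\overline 1}$ squares to zero. A subsuperring is a subring with the same unit and compatible grading. Put $\mathfrak J_R=R\cdot R_{\overline 1}=R_{\overline 1}^2\oplus R_{\overline 1}$ and $\overline R=R/\mathfrak J_R$ (the superreduced ring, a commutative ring). $R$ is a superfield if $\overline R$ is a field. Commutative rings are superrings with zero odd part. For a subsuperring $K\subseteq L$, the ring $\overline K$ acts through its image in $\overline L$ under $\overline K\to\overline L$, i.e. in $ZR(\overline L,\overline K)$ the ring $\overline K$ is understood as the image of $K$ in $\overline L$. A valuation on $R$ is a surjective map $v:R\to\mathbb G\cup\{\infty\}$, where $(\mathbb G,+,0)$ is a totally ordered abelian group (order invariant under translation) and $\infty$ is a symbol with $\infty>\alpha$ for $\alpha\in\mathbb G$ and $\infty+\alpha=\alpha+\infty=\infty+\infty=\infty$, such that $v(0)=\infty$, $v(1)=0$, $v(xy)=v(x)+v(y)$ and $v(x+y)\ge\min\{v(x),v(y)\}$ for all $x,y\in R$. It is nontrivial if $\mathbb G\ne 0$. Put $A_v=\{x\in R\mid v(x)\ge0\}$, the valuation superring of $v$. For a superfield $L$ and a subsuperring $K$ of $L$, $ZR(L,K)$ is the set consisting of all valuation superrings $A_v$ of nontrivial valuations $v$ on $L$ with $K\subseteq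 A_v$, together with the trivial valuation superring $L$ itself. It carries the Zariski topology, having as a basis of open sets the sets $U(x_1,\dots,x_n)=ZR(L,K[x_1,\dots,x_n])$ for $n\ge0$ and $x_1,\dots,x_n\in L_{\overline 0}$, where $K[x_1,\dots,x_n]$ is the subsuperring of $L$ generated by $K$ and the $x_i$. *)

theory Defs
  imports
    "HOL-Algebra.QuotRing"
    "HOL-Algebra.Ideal_Product"
    "HOL-Algebra.Subrings"
    "HOL-Analysis.Abstract_Topology"
begin

section \<open>Superrings\<close>

record 'a superring = "'a ring" +
  even_part :: "'a set"
  odd_part :: "'a set"

locale superring = ring R for R :: "('a, 'm) superring_scheme" (structure) +
  assumes one_not_zero: "\<one> \<noteq> \<zero>"
    and even_subgroup: "additive_subgroup (even_part R) R"
    and odd_subgroup: "additive_subgroup (odd_part R) R"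
    and parts_sum: "even_part R <+>\<^bsub>R\<^esub> odd_part R = carrier R"
    and parts_inter: "even_part R \<inter> odd_part R = {\<zero>}"
    and even_even: "\<lbrakk>a \<in> even_part R; b \<in> even_part R\<rbrakk> \<Longrightarrow> a \<otimes> b \<in> even_part R"
    and even_odd: "\<lbrakk>a \<in> even_part R; b \<in> odd_part R\<rbrakk> \<Longrightarrow> a \<otimes> b \<in> odd_part R"
    and odd_even: "\<lbrakk>a \<in> odd_part R; b \<in> even_part R\<rbrakk> \<Longrightarrow> a \<otimes> b \<in> odd_part R"
    and odd_odd: "\<lbrakk>a \<in> odd_part R; b \<in> odd_part R\<rbrakk> \<Longrightarrow> a \<otimes> b \<in> even_part R"
    and even_central: "\<lbrakk>a \<in> even_part R; x \<in> carrier R\<rbrakk> \<Longrightarrow> a \<otimes> x = x \<otimes> a"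
    and odd_square: "a \<in> odd_part R \<Longrightarrow> a \<otimes> a = \<zero>"

text \<open>Compatibility of the gradings says that \<open>H\<close> is the sum of its intersections with the
  even and the odd part.\<close>

definition subsuperring :: "'a set \<Rightarrow> ('a, 'm) superring_scheme \<Rightarrow> bool"
  where "subsuperring H R \<longleftrightarrow>
    subring H R \<and> (H \<inter> even_part R) <+>\<^bsub>R\<^esub> (H \<inter> odd_part R) = H"

definition odd_ideal :: "('a, 'm) superring_scheme \<Rightarrow> 'a set"
  where "odd_ideal R = carrier R \<cdot>\<^bsub>R\<^esub> odd_part R"

definition superring_of_ring :: "'a ring \<Rightarrow> 'a superring"
  where "superring_of_ring S = ring.extend S (superring.fields (carrier S) {\<zero>\<^bsub>S\<^esub>})"

definition superreduced :: "('a, 'm) superring_scheme \<Rightarrow> 'a set superring"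
  where "superreduced R = superring_of_ring (R Quot odd_ideal R)"

definition superfield :: "('a, 'm) superring_scheme \<Rightarrow> bool"
  where "superfield L \<longleftrightarrow> superring L \<and> field (L Quot odd_ideal L)"

definition superreduced_image :: "('a, 'm) superring_scheme \<Rightarrow> 'a set \<Rightarrow> 'a set set"
  where "superreduced_image L K = (\<lambda>x. odd_ideal L +>\<^bsub>L\<^esub> x) ` K"


section \<open>Valuations\<close>

text \<open>The value group is written multiplicatively, as a group of HOL-Algebra: \<open>\<one>\<^bsub>G\<^esub>\<close> and
  \<open>\<otimes>\<^bsub>G\<^esub>\<close> are the zero and the sum of the group of values, and \<open>(a, b) \<in> r\<close> means that
  \<open>a\<close> is at most \<open>b\<close>.\<close>

locale ordered_ab_group = comm_group G
  for G :: "('g, 'n) monoid_scheme" (structure) and r :: "'g rel" +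
  assumes linear: "linear_order_on (carrier G) r"
    and translation: "\<lbrakk>(a, b) \<in> r; c \<in> carrier G\<rbrakk> \<Longrightarrow> (a \<otimes> c, b \<otimes> c) \<in> r"

text \<open>The type \<open>'g option\<close> holds the group of values together with \<open>\<infinity>\<close>, which is
  \<^const>\<open>None\<close>.\<close>

fun vplus :: "('g, 'n) monoid_scheme \<Rightarrow> 'g option \<Rightarrow> 'g option \<Rightarrow> 'g option"
  where
    "vplus G (Some a) (Some b) = Some (a \<otimes>\<^bsub>G\<^esub> b)"
  | "vplus G None _ = None"
  | "vplus G _ None = None"

fun vle :: "'g rel \<Rightarrow> 'g option \<Rightarrow> 'g option \<Rightarrow> bool"
  where
    "vle r _ None \<longleftrightarrow> True"
  | "vle r None (Some b) \<longleftrightarrow> False"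
  | "vle r (Some a) (Some b) \<longleftrightarrow> (a, b) \<in> r"

definition vmin :: "'g rel \<Rightarrow> 'g option \<Rightarrow> 'g option \<Rightarrow> 'g option"
  where "vmin r a b = (if vle r a b then a else b)"

locale valuation = ring R + G: ordered_ab_group G r
  for R :: "('a, 'm) ring_scheme" and G :: "('g, 'n) monoid_scheme" and r +
  fixes v :: "'a \<Rightarrow> 'g option"
  assumes surjective: "v ` carrier R = insert None (Some ` carrier G)"
    and v_zero: "v \<zero>\<^bsub>R\<^esub> = None"
    and v_one: "v \<one>\<^bsub>R\<^esub> = Some \<one>\<^bsub>G\<^esub>"
    and v_mult: "\<lbrakk>x \<in> carrier R; y \<in> carrier R\<rbrakk> \<Longrightarrow> v (x \<otimes>\<^bsub>R\<^esub> y) = vplus G (v x) (v y)"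
    and v_add: "\<lbrakk>x \<in> carrier R; y \<in> carrier R\<rbrakk> \<Longrightarrow> vle r (vmin r (v x) (v y)) (v (x \<oplus>\<^bsub>R\<^esub> y))"

locale nontrivial_valuation = valuation +
  assumes nontrivial: "carrier G \<noteq> {\<one>\<^bsub>G\<^esub>}"

definition valuation_superring ::
    "('a, 'm) ring_scheme \<Rightarrow> ('g, 'n) monoid_scheme \<Rightarrow> 'g rel \<Rightarrow> ('a \<Rightarrow> 'g option) \<Rightarrow> 'a set"
  where "valuation_superring R G r v = {x \<in> carrier R. vle r (Some \<one>\<^bsub>G\<^esub>) (v x)}"

text \<open>Since valuations are surjective, every group of values has a copy carried by a set of
  elements of the ring. Hence nothing is lost when, below, the existential quantifier over
  valuations ranges over groups of values inside the type of the ring elements only.\<close>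

lemma valuation_transport:
  fixes R :: "('a, 'm) ring_scheme" and G :: "('g, 'n) monoid_scheme"
  assumes "valuation R G r v"
  obtains G' :: "'a monoid" and r' v' where
    "valuation R G' r' v'" "valuation_superring R G' r' v' = valuation_superring R G r v"
    "carrier G' = {\<one>\<^bsub>G'\<^esub>} \<longleftrightarrow> carrier G = {\<one>\<^bsub>G\<^esub>}"
proof -
  interpret V: valuation R G r v by fact
  have ex: "\<exists>x. x \<in> carrier R \<and> v x = Some g" if "g \<in> carrier G" for g
  proof -
    have "Some g \<in> v ` carrier R" using V.surjective that by simp
    then show ?thesis by (metis imageE)
  qed
  define s where "s g = (SOME x. x \<in> carrier R \<and> v x = Some g)" for g
  have s: "v (s g) = Some g" if "g \<in> carrier G" for g
    using someI_ex[OF ex[OF that]] by (simp add: s_def)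
  define t where "t x = the (v x)" for x
  have ts: "t (s g) = g" if "g \<in> carrier G" for g
    using s[OF that] by (simp add: t_def)
  define G' where "G' = \<lparr>carrier = s ` carrier G, mult = (\<lambda>x y. s (t x \<otimes>\<^bsub>G\<^esub> t y)),
    one = s \<one>\<^bsub>G\<^esub>\<rparr>"
  define r' where "r' = {(s a, s b) | a b. (a, b) \<in> r}"
  define v' where "v' x = map_option s (v x)" for x
  have rG: "a \<in> carrier G \<and> b \<in> carrier G" if "(a, b) \<in> r" for a b
    using V.G.linear that by (auto simp: order_on_defs)
  have r': "(s a, s b) \<in> r' \<longleftrightarrow> (a, b) \<in> r" if "a \<in> carrier G" "b \<in> carrier G" for a b
  proof
    assume "(s a, s b) \<in> r'"
    then obtain a' b' where "s a = s a'" "s b = s b'" "(a', b') \<in> r" by (auto simp: r'_def)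
    then show "(a, b) \<in> r" by (metis ts rG that)
  qed (auto simp: r'_def)
  have grp: "comm_group G'"
  proof (rule comm_groupI)
    fix x assume "x \<in> carrier G'"
    then obtain a where "a \<in> carrier G" "x = s a" by (auto simp: G'_def)
    then show "\<exists>y\<in>carrier G'. y \<otimes>\<^bsub>G'\<^esub> x = \<one>\<^bsub>G'\<^esub>"
      by (auto simp: G'_def ts intro!: bexI[of _ "inv\<^bsub>G\<^esub> a"])
  qed (auto simp: G'_def ts V.G.m_ac)
  have "refl_on (s ` carrier G) r'" "trans r'" "antisym r'" "total_on (s ` carrier G) r'"
    "r' \<subseteq> s ` carrier G \<times> s ` carrier G"
  proof -
    have L: "refl_on (carrier G) r" "trans r" "antisym r" "total_on (carrier G) r"
      using V.G.linear by (auto simp: order_on_defs)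
    show "refl_on (s ` carrier G) r'" using L(1) by (auto simp: refl_on_def r'_def)
    show "total_on (s ` carrier G) r'" using L(4) by (fastforce simp: total_on_def r')
    show "r' \<subseteq> s ` carrier G \<times> s ` carrier G" using rG by (auto simp: r'_def)
    show "antisym r'"
    proof (rule antisymI)
      fix x y assume "(x, y) \<in> r'" "(y, x) \<in> r'"
      moreover from this(1) obtain a b where "x = s a" "y = s b" "(a, b) \<in> r"
        by (auto simp: r'_def)
      ultimately show "x = y" using r' rG L(3) by (metis antisymD)
    qed
    show "trans r'"
    proof (rule transI)
      fix x y z assume "(x, y) \<in> r'" "(y, z) \<in> r'"
      then obtain a b b' c where *: "x = s a" "y = s b" "y = s b'" "z = s c" "(a, b) \<in> r" "(b', c) \<in> r"
        by (auto simp: r'_def)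
      then have "b = b'" using ts rG by metis
      then have "(a, c) \<in> r" using * L(2) by (blast dest: transD)
      then show "(x, z) \<in> r'" using * by (auto simp: r'_def)
    qed
  qed
  then have lin: "linear_order_on (carrier G') r'" by (simp add: order_on_defs G'_def)
  have tr: "(x \<otimes>\<^bsub>G'\<^esub> z, y \<otimes>\<^bsub>G'\<^esub> z) \<in> r'" if xy: "(x, y) \<in> r'" and z: "z \<in> carrier G'" for x y z
  proof -
    obtain a b where "x = s a" "y = s b" "(a, b) \<in> r" using xy by (auto simp: r'_def)
    moreover obtain c where "c \<in> carrier G" "z = s c" using z by (auto simp: G'_def)
    ultimately show ?thesis using rG[of a b] V.G.translation by (auto simp: G'_def ts r')
  qed
  have val: "v x = None \<or> (\<exists>g \<in> carrier G. v x = Some g)" if "x \<in> carrier R" for x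
    using V.surjective that by blast
  have le': "vle r' (map_option s p) (map_option s q) \<longleftrightarrow> vle r p q"
    if "p = None \<or> (\<exists>g \<in> carrier G. p = Some g)" "q = None \<or> (\<exists>g \<in> carrier G. q = Some g)" for p q
    using that by (auto simp: r')
  have V': "valuation R G' r' v'"
  proof (intro valuation.intro ordered_ab_group.intro ordered_ab_group_axioms.intro
      valuation_axioms.intro grp lin tr V.ring_axioms)
    have "v' ` carrier R = map_option s ` (v ` carrier R)" by (auto simp: v'_def)
    then show "v' ` carrier R = insert None (Some ` carrier G')"
      by (simp add: V.surjective G'_def image_image)
    show "v' \<zero>\<^bsub>R\<^esub> = None" by (simp add: v'_def V.v_zero)
    show "v' \<one>\<^bsub>R\<^esub> = Some \<one>\<^bsub>G'\<^esub>" by (simp add: v'_def V.v_one G'_def)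
    fix x y assume x: "x \<in> carrier R" and y: "y \<in> carrier R"
    show "v' (x \<otimes>\<^bsub>R\<^esub> y) = vplus G' (v' x) (v' y)"
      using val[OF x] val[OF y] by (auto simp: v'_def V.v_mult x y G'_def ts)
    have "vmin r' (v' x) (v' y) = map_option s (vmin r (v x) (v y))"
      by (simp add: vmin_def v'_def le'[OF val val] x y)
    moreover have "vmin r (v x) (v y) \<in> {v x, v y}" by (simp add: vmin_def)
    ultimately show "vle r' (vmin r' (v' x) (v' y)) (v' (x \<oplus>\<^bsub>R\<^esub> y))"
      using V.v_add[OF x y] x y val by (auto simp: v'_def le')
  qed
  have "vle r' (Some \<one>\<^bsub>G'\<^esub>) (v' x) \<longleftrightarrow> vle r (Some \<one>\<^bsub>G\<^esub>) (v x)" if "x \<in> carrier R" for x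
    using le'[of "Some \<one>\<^bsub>G\<^esub>" "v x"] val[OF that] by (simp add: v'_def G'_def)
  then have "valuation_superring R G' r' v' = valuation_superring R G r v"
    by (auto simp: valuation_superring_def)
  moreover have "carrier G' = {\<one>\<^bsub>G'\<^esub>} \<longleftrightarrow> carrier G = {\<one>\<^bsub>G\<^esub>}"
  proof
    assume *: "carrier G' = {\<one>\<^bsub>G'\<^esub>}"
    have "g = \<one>\<^bsub>G\<^esub>" if "g \<in> carrier G" for g
    proof -
      have "s g = s \<one>\<^bsub>G\<^esub>" using * that by (auto simp: G'_def)
      then show ?thesis using ts that by (metis V.G.one_closed)
    qed
    then show "carrier G = {\<one>\<^bsub>G\<^esub>}" using V.G.one_closed by blast
  qed (simp add: G'_def)
  ultimately show thesis using V' that by blast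
qed


section \<open>The Zariski--Riemann space\<close>

definition ZR :: "('a, 'm) superring_scheme \<Rightarrow> 'a set \<Rightarrow> 'a set set"
  where "ZR L K =
    {valuation_superring L G r v | (G :: 'a monoid) r v.
      nontrivial_valuation L G r v \<and> K \<subseteq> valuation_superring L G r v} \<union> {carrier L}"

definition adjoin :: "('a, 'm) superring_scheme \<Rightarrow> 'a set \<Rightarrow> 'a set \<Rightarrow> 'a set"
  where "adjoin L K X = (\<lambda>H. subsuperring H L) hull (K \<union> X)"

definition ZR_base :: "('a, 'm) superring_scheme \<Rightarrow> 'a set \<Rightarrow> 'a set set set"
  where "ZR_base L K = {ZR L (adjoin L K (set xs)) | xs. set xs \<subseteq> even_part L}"

definition ZR_topology :: "('a, 'm) superring_scheme \<Rightarrow> 'a set \<Rightarrow> 'a set topology"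
  where "ZR_topology L K = topology (arbitrary union_of (\<lambda>U. U \<in> ZR_base L K))"


text \<open>The sets \<^term>\<open>ZR_base L K\<close> are indeed the basis of a topology on \<^term>\<open>ZR L K\<close>.\<close>

lemma (in valuation) subring_valuation_superring:
  "subring (valuation_superring R G r v) R"
proof -
  have L: "refl_on (carrier G) r" "trans r" "antisym r" "total_on (carrier G) r"
    using G.linear by (auto simp: order_on_defs)
  have val: "v x = None \<or> (\<exists>g \<in> carrier G. v x = Some g)" if "x \<in> carrier R" for x
    using surjective that by blast
  have pos_mult: "(\<one>\<^bsub>G\<^esub>, a \<otimes>\<^bsub>G\<^esub> b) \<in> r"
    if "(\<one>\<^bsub>G\<^esub>, a) \<in> r" "(\<one>\<^bsub>G\<^esub>, b) \<in> r" "a \<in> carrier G" "b \<in> carrier G" for a b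
    using G.translation[OF that(1) that(4)] that L(2) by (auto dest: transD)
  have mult: "x \<otimes>\<^bsub>R\<^esub> y \<in> valuation_superring R G r v"
    if "x \<in> valuation_superring R G r v" "y \<in> valuation_superring R G r v" for x y
    using that val[of x] val[of y]
    by (auto simp: valuation_superring_def v_mult pos_mult)
  have vm: "v (\<ominus>\<^bsub>R\<^esub> \<one>\<^bsub>R\<^esub>) = Some \<one>\<^bsub>G\<^esub>"
  proof -
    have *: "vplus G (v (\<ominus>\<^bsub>R\<^esub> \<one>\<^bsub>R\<^esub>)) (v (\<ominus>\<^bsub>R\<^esub> \<one>\<^bsub>R\<^esub>)) = Some \<one>\<^bsub>G\<^esub>"
      using v_mult[of "\<ominus>\<^bsub>R\<^esub> \<one>\<^bsub>R\<^esub>" "\<ominus>\<^bsub>R\<^esub> \<one>\<^bsub>R\<^esub>"] by (simp add: l_minus v_one)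
    then obtain g where g: "g \<in> carrier G" "v (\<ominus>\<^bsub>R\<^esub> \<one>\<^bsub>R\<^esub>) = Some g" using val[of "\<ominus>\<^bsub>R\<^esub> \<one>\<^bsub>R\<^esub>"] by auto
    with * have gg: "g \<otimes>\<^bsub>G\<^esub> g = \<one>\<^bsub>G\<^esub>" by simp
    have "(\<one>\<^bsub>G\<^esub>, g) \<in> r \<or> (g, \<one>\<^bsub>G\<^esub>) \<in> r"
      using L(1,4) g(1) by (metis G.one_closed refl_onD total_on_def)
    then have "(\<one>\<^bsub>G\<^esub>, g) \<in> r \<and> (g, \<one>\<^bsub>G\<^esub>) \<in> r"
      using G.translation[of "\<one>\<^bsub>G\<^esub>" g g] G.translation[of g "\<one>\<^bsub>G\<^esub>" g] g(1) by (auto simp: gg)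
    then have "g = \<one>\<^bsub>G\<^esub>" using L(3) by (auto dest: antisymD)
    then show ?thesis using g by simp
  qed
  show ?thesis
  proof (rule subringI)
    show "valuation_superring R G r v \<subseteq> carrier R" by (auto simp: valuation_superring_def)
    have "(\<one>\<^bsub>G\<^esub>, \<one>\<^bsub>G\<^esub>) \<in> r" using L(1) by (simp add: refl_on_def)
    then show "\<one>\<^bsub>R\<^esub> \<in> valuation_superring R G r v" by (simp add: valuation_superring_def v_one)
    have m1: "\<ominus>\<^bsub>R\<^esub> \<one>\<^bsub>R\<^esub> \<in> valuation_superring R G r v"
      using \<open>(\<one>\<^bsub>G\<^esub>, \<one>\<^bsub>G\<^esub>) \<in> r\<close> by (simp add: valuation_superring_def vm)
    fix x assume x: "x \<in> valuation_superring R G r v"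
    then have "x \<in> carrier R" by (simp add: valuation_superring_def)
    then show "\<ominus>\<^bsub>R\<^esub> x \<in> valuation_superring R G r v"
      using mult[OF m1 x] by (simp add: l_minus)
    fix y assume y: "y \<in> valuation_superring R G r v"
    show "x \<otimes>\<^bsub>R\<^esub> y \<in> valuation_superring R G r v" using mult x y .
    have xy: "x \<in> carrier R" "y \<in> carrier R" using x y by (auto simp: valuation_superring_def)
    have "vle r (Some \<one>\<^bsub>G\<^esub>) (vmin r (v x) (v y))"
      using x y by (simp add: valuation_superring_def vmin_def)
    then show "x \<oplus>\<^bsub>R\<^esub> y \<in> valuation_superring R G r v"
      using v_add[OF xy] xy val[of x] val[of y] val[of "x \<oplus>\<^bsub>R\<^esub> y"] L(2)
      by (auto simp: valuation_superring_def vmin_def split: if_splits dest: transD)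
  qed
qed

lemma (in superring) subsuperring_carrier: "subsuperring (carrier R) R"
proof -
  have "even_part R \<subseteq> carrier R" "odd_part R \<subseteq> carrier R"
    using even_subgroup odd_subgroup by (auto dest: additive_subgroup.a_subset)
  then show ?thesis
    using carrier_is_subring parts_sum by (simp add: subsuperring_def Int_absorb1)
qed

lemma (in superring) subsuperring_valuation_superring:
  assumes "valuation R G r v"
  shows "subsuperring (valuation_superring R G r v) R"
proof -
  interpret V: valuation R G r v by fact
  let ?A = "valuation_superring R G r v"
  have sub: "subring ?A R" by (rule V.subring_valuation_superring)
  have carr: "even_part R \<subseteq> carrier R" "odd_part R \<subseteq> carrier R"
    using even_subgroup odd_subgroup by (auto dest: additive_subgroup.a_subset)
  have odd: "y \<in> ?A" if "y \<in> odd_part R" for y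
  proof -
    have y: "y \<in> carrier R" using that carr by auto
    have "vplus G (v y) (v y) = None"
      using V.v_mult[OF y y] odd_square[OF that] V.v_zero by simp
    then have "v y = None" by (cases "v y") auto
    then show ?thesis using y by (simp add: valuation_superring_def)
  qed
  have "?A \<subseteq> (?A \<inter> even_part R) <+>\<^bsub>R\<^esub> (?A \<inter> odd_part R)"
  proof
    fix x assume x: "x \<in> ?A"
    then have "x \<in> even_part R <+>\<^bsub>R\<^esub> odd_part R"
      by (simp add: parts_sum valuation_superring_def)
    then obtain a b where ab: "a \<in> even_part R" "b \<in> odd_part R" "x = a \<oplus> b"
      by (auto simp: set_add_def')
    moreover from ab(1,2) carr have "a \<in> carrier R" "b \<in> carrier R" by auto
    ultimately have "a = x \<oplus> \<ominus> b" by (simp add: a_assoc r_neg)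
    moreover have "x \<oplus> \<ominus> b \<in> ?A" using subringE(5,7)[OF sub] x odd ab(2) by blast
    ultimately have "a \<in> ?A" by simp
    then show "x \<in> (?A \<inter> even_part R) <+>\<^bsub>R\<^esub> (?A \<inter> odd_part R)"
      using ab odd by (auto simp: set_add_def')
  qed
  moreover have "(?A \<inter> even_part R) <+>\<^bsub>R\<^esub> (?A \<inter> odd_part R) \<subseteq> ?A"
    using subringE(7)[OF sub] by (auto simp: set_add_def')
  ultimately show ?thesis using sub by (auto simp: subsuperring_def)
qed

lemma (in superring) ZR_subsuperring: "A \<in> ZR R K \<Longrightarrow> subsuperring A R"
  by (auto simp: ZR_def nontrivial_valuation_def
      intro: subsuperring_valuation_superring subsuperring_carrier)

lemma (in superring) ZR_adjoin:
  assumes "K \<subseteq> carrier R" "X \<subseteq> carrier R"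
  shows "ZR R (adjoin R K X) = {A \<in> ZR R K. X \<subseteq> A}"
proof -
  have *: "adjoin R K X \<subseteq> A \<longleftrightarrow> K \<subseteq> A \<and> X \<subseteq> A" if "subsuperring A R" for A
    using that hull_subset[of "K \<union> X" "\<lambda>H. subsuperring H R"]
      hull_minimal[of "K \<union> X" A "\<lambda>H. subsuperring H R"]
    unfolding adjoin_def by auto
  show ?thesis
    using assms
    by (auto simp: ZR_def * nontrivial_valuation_def subsuperring_valuation_superring)
qed

lemma (in superring)
  assumes "K \<subseteq> carrier R"
  shows openin_ZR_topology:
      "openin (ZR_topology R K) = arbitrary union_of (\<lambda>U. U \<in> ZR_base R K)"
    and topspace_ZR_topology: "topspace (ZR_topology R K) = ZR R K"
proof -
  have carr: "even_part R \<subseteq> carrier R"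
    using even_subgroup by (auto dest: additive_subgroup.a_subset)
  have base: "ZR_base R K = {{A \<in> ZR R K. set xs \<subseteq> A} | xs. set xs \<subseteq> even_part R}"
  proof -
    have "ZR R (adjoin R K (set xs)) = {A \<in> ZR R K. set xs \<subseteq> A}" if "set xs \<subseteq> even_part R" for xs
      using that carr by (intro ZR_adjoin assms) auto
    then show ?thesis unfolding ZR_base_def by blast
  qed
  have "U \<inter> V \<in> ZR_base R K" if UV: "U \<in> ZR_base R K" "V \<in> ZR_base R K" for U V
  proof -
    obtain xs ys where "U = {A \<in> ZR R K. set xs \<subseteq> A}" "V = {A \<in> ZR R K. set ys \<subseteq> A}"
      "set xs \<subseteq> even_part R" "set ys \<subseteq> even_part R"
      using UV unfolding base by auto
    then have "U \<inter> V = {A \<in> ZR R K. set (xs @ ys) \<subseteq> A} \<and> set (xs @ ys) \<subseteq> even_part R" by auto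
    then show ?thesis unfolding base
      by (intro CollectI exI[of _ "xs @ ys"])
  qed
  then have "istopology (arbitrary union_of (\<lambda>U. U \<in> ZR_base R K))"
    by (rule istopology_base)
  then show op: "openin (ZR_topology R K) = arbitrary union_of (\<lambda>U. U \<in> ZR_base R K)"
    by (simp add: ZR_topology_def topology_inverse')
  have "\<Union> (ZR_base R K) = ZR R K"
  proof
    have "ZR R K = {A \<in> ZR R K. set [] \<subseteq> A} \<and> set [] \<subseteq> even_part R" by simp
    then have "ZR R K \<in> ZR_base R K" unfolding base by blast
    then show "ZR R K \<subseteq> \<Union> (ZR_base R K)" by blast
  qed (auto simp: base)
  moreover have "topspace (ZR_topology R K) = \<Union> (ZR_base R K)"
    unfolding topspace_def op by (auto simp: union_of_def arbitrary_def)
  ultimately show "topspace (ZR_topology R K) = ZR R K" by simp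
qed

end

theory Submission
  imports Defs
begin

text \<open>
  Odd elements square to zero, so a valuation on a superring takes the value \<open>\<infinity>\<close> on them, hence
  on the whole ideal \<open>\<JJ>\<close> they generate. A valuation does not change when an element of value
  \<open>\<infinity>\<close> is added to its argument, so it is constant on the cosets of \<open>\<JJ>\<close>: the valuations on
  \<open>L\<close> are exactly the compositions of the valuations on \<open>L/\<JJ>\<close> with the projection, with the same
  group of values. Accordingly \<open>A \<mapsto> A/\<JJ>\<close> and the inverse image under the projection are mutually
  inverse bijections between the valuation superrings of \<open>L\<close> and those of \<open>L/\<JJ>\<close>.

  For the topology, every element of \<open>L/\<JJ>\<close> is the class of an even element, since the odd
  component of a representative lies in \<open>\<JJ>\<close>. The basic open sets are the sets
  \<open>{A. x\<^sub>1, \<dots>, x\<^sub>n \<in> A}\<close> with even \<open>x\<^sub>i\<close>, and an element \<open>x\<close> lies in \<open>A\<close> if and only if its class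
  lies in \<open>A/\<JJ>\<close>. So the two bases correspond to each other under the bijection. The argument is
  carried out for any surjection of superrings which maps the even part onto the even part and whose
  kernel lies in \<open>\<JJ>\<close>; the projection \<open>L \<rightarrow> L/\<JJ>\<close> is such a map.
\<close>


section \<open>Valuations and surjective homomorphisms\<close>

lemma vplus_None_right [simp]: "vplus G a None = None"
  by (cases a) auto

lemma (in valuation) value_cases:
  assumes "x \<in> carrier R"
  shows "v x = None \<or> (\<exists>g \<in> carrier G. v x = Some g)"
  using surjective assms by blast

lemma (in valuation) value_add_infinite_le:
  assumes "x \<in> carrier R" "y \<in> carrier R" "v y = None"
  shows "vle r (v x) (v (x \<oplus>\<^bsub>R\<^esub> y))"
  using v_add[OF assms(1,2)] assms(3) by (simp add: vmin_def)

text \<open>Both \<open>y\<close> and \<open>-y\<close> have value \<open>\<infinity>\<close>, so adding \<open>y\<close> and then taking it away again cannot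
  decrease the value; antisymmetry gives equality.\<close>

lemma (in valuation) value_add_infinite:
  assumes x: "x \<in> carrier R" and y: "y \<in> carrier R" and inf: "v y = None"
  shows "v (x \<oplus>\<^bsub>R\<^esub> y) = v x"
proof -
  have "v (\<ominus>\<^bsub>R\<^esub> \<one>\<^bsub>R\<^esub> \<otimes>\<^bsub>R\<^esub> y) = None"
    using y inf by (simp add: v_mult del: l_minus)
  then have neg: "v (\<ominus>\<^bsub>R\<^esub> y) = None" using y by (simp add: l_minus)
  have up: "vle r (v x) (v (x \<oplus>\<^bsub>R\<^esub> y))" by (rule value_add_infinite_le[OF x y inf])
  have "vle r (v (x \<oplus>\<^bsub>R\<^esub> y)) (v (x \<oplus>\<^bsub>R\<^esub> y \<oplus>\<^bsub>R\<^esub> \<ominus>\<^bsub>R\<^esub> y))"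
    using x y neg by (intro value_add_infinite_le) auto
  moreover have "x \<oplus>\<^bsub>R\<^esub> y \<oplus>\<^bsub>R\<^esub> \<ominus>\<^bsub>R\<^esub> y = x"
    using x y by (simp add: a_assoc r_neg)
  ultimately have down: "vle r (v (x \<oplus>\<^bsub>R\<^esub> y)) (v x)" by simp
  have "antisym r" using G.linear by (auto simp: order_on_defs)
  then show ?thesis
    using up down by (cases "v x"; cases "v (x \<oplus>\<^bsub>R\<^esub> y)") (auto dest: antisymD)
qed

lemma (in ring_hom_ring) valuation_pullback:
  assumes surj: "h ` carrier R = carrier S" and "valuation S G r w"
  shows "valuation R G r (w \<circ> h)"
proof -
  interpret W: valuation S G r w by fact
  show ?thesis
  proof (intro valuation.intro valuation_axioms.intro)
    show "ring R" "ordered_ab_group G r" by unfold_locales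
    show "(w \<circ> h) ` carrier R = insert None (Some ` carrier G)"
      by (simp only: image_comp[symmetric] surj W.surjective)
  qed (auto simp: W.v_zero W.v_one W.v_mult W.v_add)
qed

lemma (in ring_hom_ring) valuation_descent:
  assumes surj: "h ` carrier R = carrier S" and "valuation R G r v"
    and ker: "\<And>x. \<lbrakk>x \<in> carrier R; h x = \<zero>\<^bsub>S\<^esub>\<rbrakk> \<Longrightarrow> v x = None"
  obtains w where "valuation S G r w" "\<And>x. x \<in> carrier R \<Longrightarrow> w (h x) = v x"
proof -
  interpret V: valuation R G r v by fact
  have fibre: "v x = v y" if xy: "x \<in> carrier R" "y \<in> carrier R" "h x = h y" for x y
  proof -
    have "v (\<ominus>\<^bsub>R\<^esub> y \<oplus>\<^bsub>R\<^esub> x) = None"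
      using xy by (intro ker) (auto simp: S.l_neg)
    then have "v (y \<oplus>\<^bsub>R\<^esub> (\<ominus>\<^bsub>R\<^esub> y \<oplus>\<^bsub>R\<^esub> x)) = v y"
      using xy by (intro V.value_add_infinite) auto
    then show ?thesis using xy by (simp add: R.r_neg R.a_assoc[symmetric])
  qed
  define w where "w = v \<circ> inv_into (carrier R) h"
  have w: "w (h x) = v x" if "x \<in> carrier R" for x
    unfolding w_def comp_def using that by (intro fibre inv_into_into f_inv_into_f) auto
  have "valuation S G r w"
  proof (intro valuation.intro valuation_axioms.intro)
    show "ring S" "ordered_ab_group G r" by unfold_locales
    have "w ` carrier S = v ` carrier R"
      unfolding surj[symmetric] image_image by (rule image_cong) (auto simp: w)
    then show "w ` carrier S = insert None (Some ` carrier G)"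
      by (simp add: V.surjective)
    show "w \<zero>\<^bsub>S\<^esub> = None" using w[of "\<zero>\<^bsub>R\<^esub>"] by (simp add: V.v_zero)
    show "w \<one>\<^bsub>S\<^esub> = Some \<one>\<^bsub>G\<^esub>" using w[of "\<one>\<^bsub>R\<^esub>"] by (simp add: V.v_one)
    fix s t assume "s \<in> carrier S" "t \<in> carrier S"
    then obtain x y where xy: "x \<in> carrier R" "y \<in> carrier R" "s = h x" "t = h y"
      unfolding surj[symmetric] by blast
    then show "w (s \<otimes>\<^bsub>S\<^esub> t) = vplus G (w s) (w t)"
      using w[of "x \<otimes>\<^bsub>R\<^esub> y"] by (simp add: w V.v_mult)
    show "vle r (vmin r (w s) (w t)) (w (s \<oplus>\<^bsub>S\<^esub> t))"
      using xy w[of "x \<oplus>\<^bsub>R\<^esub> y"] V.v_add[of x y] by (simp add: w)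
  qed
  then show thesis using that w by blast
qed


section \<open>The ideal generated by the odd part\<close>

lemma (in superring) even_part_subset: "even_part R \<subseteq> carrier R"
  using even_subgroup by (auto dest: additive_subgroup.a_subset)

lemma (in superring) odd_part_subset: "odd_part R \<subseteq> carrier R"
  using odd_subgroup by (auto dest: additive_subgroup.a_subset)

lemma (in superring) even_odd_decomposition:
  assumes "x \<in> carrier R"
  obtains a b where "a \<in> even_part R" "b \<in> odd_part R" "x = a \<oplus> b"
  using assms unfolding parts_sum[symmetric] by (auto simp: set_add_def')

lemma (in superring) odd_anticommute:
  assumes a: "a \<in> odd_part R" and b: "b \<in> odd_part R"
  shows "a \<otimes> b = \<ominus> (b \<otimes> a)"
proof -
  have carr: "a \<in> carrier R" "b \<in> carrier R" using a b odd_part_subset by auto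
  have "(a \<oplus> b) \<otimes> (a \<oplus> b) = \<zero>"
    using a b odd_subgroup by (intro odd_square) (simp add: additive_subgroup.a_closed)
  then have "a \<otimes> b \<oplus> b \<otimes> a = \<zero>"
    using carr odd_square[OF a] odd_square[OF b] by (simp add: l_distr r_distr a_ac)
  then show ?thesis using carr by (simp add: minus_equality)
qed

lemma (in superring) odd_ideal_subset: "odd_ideal R \<subseteq> carrier R"
proof
  fix x assume "x \<in> odd_ideal R"
  then show "x \<in> carrier R"
    unfolding odd_ideal_def using odd_part_subset by induction auto
qed

lemma (in superring) odd_part_subset_odd_ideal: "odd_part R \<subseteq> odd_ideal R"
proof
  fix b assume b: "b \<in> odd_part R"
  then have "\<one> \<otimes> b \<in> odd_ideal R"
    unfolding odd_ideal_def by (intro ideal_prod.prod) auto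
  then show "b \<in> odd_ideal R" using b odd_part_subset by auto
qed

text \<open>Products \<open>cb\<close> with \<open>b\<close> odd are obviously stable under multiplication from the left. From the
  right, \<open>b\<close> commutes with the even component of the factor and anticommutes with its odd component,
  so that the factor can be moved to the left of \<open>b\<close>.\<close>

lemma (in superring) ideal_odd_ideal: "ideal (odd_ideal R) R"
proof (rule idealI)
  have prod: "c \<otimes> b \<in> odd_ideal R" if "c \<in> carrier R" "b \<in> odd_part R" for c b
    using that unfolding odd_ideal_def by (rule ideal_prod.prod)
  have sum: "x \<oplus> y \<in> odd_ideal R" if "x \<in> odd_ideal R" "y \<in> odd_ideal R" for x y
    using that unfolding odd_ideal_def by (rule ideal_prod.sum)
  have l_closed: "x \<otimes> a \<in> odd_ideal R" if "a \<in> odd_ideal R" "x \<in> carrier R" for a x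
    using that(1) unfolding odd_ideal_def
  proof induction
    case (prod c b)
    then have "x \<otimes> (c \<otimes> b) = (x \<otimes> c) \<otimes> b"
      using that(2) odd_part_subset by (auto simp: m_assoc)
    then show ?case using prod that(2) by (auto intro: ideal_prod.prod)
  next
    case (sum s t)
    then have "s \<in> carrier R" "t \<in> carrier R"
      using odd_ideal_subset by (auto simp: odd_ideal_def)
    then show ?case using sum that(2) by (auto simp: r_distr intro: ideal_prod.sum)
  qed
  show "x \<otimes> a \<in> odd_ideal R" if "a \<in> odd_ideal R" "x \<in> carrier R" for a x
    by (rule l_closed[OF that])
  show "a \<otimes> x \<in> odd_ideal R" if "a \<in> odd_ideal R" "x \<in> carrier R" for a x
    using that(1) unfolding odd_ideal_def
  proof induction
    case (prod c b)
    obtain e d where x: "e \<in> even_part R" "d \<in> odd_part R" "x = e \<oplus> d"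
      using even_odd_decomposition[OF \<open>x \<in> carrier R\<close>] .
    have carr: "b \<in> carrier R" "e \<in> carrier R" "d \<in> carrier R"
      using prod x even_part_subset odd_part_subset by auto
    have "b \<otimes> x = (e \<oplus> \<ominus> d) \<otimes> b"
      using carr x even_central[OF x(1) carr(1)] odd_anticommute[OF prod(2) x(2)]
      by (simp add: l_distr r_distr l_minus)
    then have "c \<otimes> b \<otimes> x = (c \<otimes> (e \<oplus> \<ominus> d)) \<otimes> b"
      using prod(1) carr \<open>x \<in> carrier R\<close> by (simp add: m_assoc)
    then show ?case using prod carr by (auto intro: ideal_prod.prod)
  next
    case (sum s t)
    then have "s \<in> carrier R" "t \<in> carrier R"
      using odd_ideal_subset by (auto simp: odd_ideal_def)
    then show ?case using sum that(2) by (auto simp: l_distr intro: ideal_prod.sum)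
  qed
  have zero: "\<zero> \<in> odd_ideal R"
    using odd_subgroup odd_part_subset_odd_ideal by (auto dest: additive_subgroup.zero_closed)
  have neg: "\<ominus> a \<in> odd_ideal R" if "a \<in> odd_ideal R" for a
    using l_closed[OF that, of "\<ominus> \<one>"] that odd_ideal_subset by (auto simp: l_minus)
  show "subgroup (odd_ideal R) (add_monoid R)"
    by (rule add.subgroupI)
      (use odd_ideal_subset zero neg sum in \<open>auto simp: a_inv_def[symmetric]\<close>)
qed (rule ring_axioms)

text \<open>Doubling the value of an odd element gives the value of its square, which is \<open>\<infinity>\<close>.\<close>

lemma (in superring) valuation_odd_ideal:
  assumes "valuation R G r v" "x \<in> odd_ideal R"
  shows "v x = None"
proof -
  interpret V: valuation R G r v by fact
  have odd: "v b = None" if "b \<in> odd_part R" for b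
  proof -
    have "b \<in> carrier R" using that odd_part_subset by auto
    then have "vplus G (v b) (v b) = None"
      using V.v_mult[of b b] odd_square[OF that] V.v_zero by simp
    then show ?thesis by (cases "v b") auto
  qed
  show ?thesis
    using assms(2) unfolding odd_ideal_def
  proof induction
    case (prod c b)
    then show ?case using odd odd_part_subset by (auto simp: V.v_mult)
  next
    case (sum s t)
    then have "s \<in> carrier R" "t \<in> carrier R"
      using odd_ideal_subset by (auto simp: odd_ideal_def)
    then show ?case using V.value_add_infinite sum by auto
  qed
qed


section \<open>Zariski--Riemann spaces along surjections with kernel in the odd ideal\<close>

text \<open>The members of \<^const>\<open>ZR\<close> are given by valuations with values in groups carried by the
  type of the ring elements. A valuation transferred along a homomorphism keeps its group of values,
  which is then carried by the type of the other ring; the fact \<open>valuation_transport\<close> moves it.\<close>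

lemma ZR_memI:
  assumes "nontrivial_valuation R G r v" "K \<subseteq> valuation_superring R G r v"
  shows "valuation_superring R G r v \<in> ZR R K"
proof -
  have v: "valuation R G r v" and nt: "carrier G \<noteq> {\<one>\<^bsub>G\<^esub>}"
    using assms(1) by (auto simp: nontrivial_valuation_def nontrivial_valuation_axioms_def)
  obtain G' :: "'a monoid" and r' v' where
    "valuation R G' r' v'" "valuation_superring R G' r' v' = valuation_superring R G r v"
    "carrier G' = {\<one>\<^bsub>G'\<^esub>} \<longleftrightarrow> carrier G = {\<one>\<^bsub>G\<^esub>}"
    using valuation_transport[OF v] by metis
  then have "nontrivial_valuation R G' r' v'"
    "valuation_superring R G r v = valuation_superring R G' r' v'"
    "K \<subseteq> valuation_superring R G' r' v'"
    using nt assms(2) by (auto simp: nontrivial_valuation_def nontrivial_valuation_axioms_def)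
  then show ?thesis unfolding ZR_def by blast
qed

lemma (in superring) ZR_base_eq:
  assumes "K \<subseteq> carrier R"
  shows "ZR_base R K = {{A \<in> ZR R K. set xs \<subseteq> A} | xs. set xs \<subseteq> even_part R}"
proof -
  have "ZR R (adjoin R K (set xs)) = {A \<in> ZR R K. set xs \<subseteq> A}" if "set xs \<subseteq> even_part R" for xs
    using that even_part_subset by (intro ZR_adjoin assms) auto
  then show ?thesis unfolding ZR_base_def by blast
qed

locale superring_odd_quotient =
  R?: superring R + S?: superring S + ring_hom_ring R S h
  for R :: "('a, 'm) superring_scheme" (structure)
    and S :: "('b, 'n) superring_scheme" (structure) and h +
  assumes surj: "h ` carrier R = carrier S"
    and even_image: "h ` even_part R = even_part S"
    and kernel: "\<lbrakk>x \<in> carrier R; h x = \<zero>\<^bsub>S\<^esub>\<rbrakk> \<Longrightarrow> x \<in> odd_ideal R"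
begin

definition preimage :: "'b set \<Rightarrow> 'a set"
  where "preimage B = {x \<in> carrier R. h x \<in> B}"

lemma image_preimage: "B \<subseteq> carrier S \<Longrightarrow> h ` preimage B = B"
  unfolding preimage_def using surj by auto

lemma ZR_subset_carrier:
  "A \<in> ZR R K \<Longrightarrow> A \<subseteq> carrier R" "B \<in> ZR S M \<Longrightarrow> B \<subseteq> carrier S"
  by (auto simp: ZR_def valuation_superring_def)

lemma preimage_ZR:
  assumes K: "K \<subseteq> carrier R" and B: "B \<in> ZR S (h ` K)"
  shows "preimage B \<in> ZR R K"
proof -
  consider "B = carrier S" | (val) G :: "'b monoid" and r w where
    "nontrivial_valuation S G r w" "B = valuation_superring S G r w" "h ` K \<subseteq> B"
    using B unfolding ZR_def by blast
  then show ?thesis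
  proof cases
    case 1
    then have "preimage B = carrier R" by (auto simp: preimage_def)
    then show ?thesis by (simp add: ZR_def)
  next
    case val
    then have "nontrivial_valuation R G r (w \<circ> h)"
      using valuation_pullback[OF surj] by (auto simp: nontrivial_valuation_def)
    moreover have "preimage B = valuation_superring R G r (w \<circ> h)"
      using val(2) by (auto simp: preimage_def valuation_superring_def)
    moreover have "K \<subseteq> preimage B" using K val(3) by (auto simp: preimage_def)
    ultimately show ?thesis using ZR_memI by metis
  qed
qed

lemma ZR_image:
  assumes A: "A \<in> ZR R K"
  shows "h ` A \<in> ZR S (h ` K)" "preimage (h ` A) = A"
proof -
  consider "A = carrier R" | (val) G :: "'a monoid" and r v where
    "nontrivial_valuation R G r v" "A = valuation_superring R G r v" "K \<subseteq> A"
    using A unfolding ZR_def by blast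
  then have "h ` A \<in> ZR S (h ` K) \<and> preimage (h ` A) = A"
  proof cases
    case 1
    then show ?thesis using surj by (auto simp: preimage_def ZR_def)
  next
    case val
    then have v: "valuation R G r v" by (simp add: nontrivial_valuation_def)
    obtain w where w: "valuation S G r w" "\<And>x. x \<in> carrier R \<Longrightarrow> w (h x) = v x"
      using valuation_descent[OF surj v] R.valuation_odd_ideal[OF v] kernel by blast
    have nt: "nontrivial_valuation S G r w"
      using val(1) w(1) by (auto simp: nontrivial_valuation_def)
    have A_eq: "A = preimage (valuation_superring S G r w)"
      using val(2) w(2) by (auto simp: preimage_def valuation_superring_def)
    then have hA: "h ` A = valuation_superring S G r w"
      using image_preimage by (simp add: valuation_superring_def)
    have "h ` K \<subseteq> h ` A" using val(3) by auto
    then show ?thesis using ZR_memI[OF nt] hA A_eq by simp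
  qed
  then show "h ` A \<in> ZR S (h ` K)" "preimage (h ` A) = A" by auto
qed

text \<open>The basic open set of \<open>x\<^sub>1, \<dots>, x\<^sub>n\<close> corresponds to the basic open set of
  \<open>h x\<^sub>1, \<dots>, h x\<^sub>n\<close>. Since \<open>h\<close> maps the even part onto the even part, all basic open sets on
  both sides take part in this correspondence.\<close>

theorem ZR_homeomorphic_maps:
  assumes K: "K \<subseteq> carrier R"
  shows "homeomorphic_maps (ZR_topology R K) (ZR_topology S (h ` K)) ((`) h) preimage"
proof -
  have hK: "h ` K \<subseteq> carrier S" using K by auto
  note base_R = R.ZR_base_eq[OF K] and base_S = S.ZR_base_eq[OF hK]
  note open_R = R.openin_ZR_topology[OF K] and open_S = S.openin_ZR_topology[OF hK]
  note top = R.topspace_ZR_topology[OF K] S.topspace_ZR_topology[OF hK]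
  have open_baseI: "openin X U" if "openin X = arbitrary union_of P" "P U"
    for X :: "'c topology" and P U
    using that by (auto simp: union_of_def arbitrary_def intro!: exI[of _ "{U}"])
  have "continuous_map (ZR_topology R K) (ZR_topology S (h ` K)) ((`) h)"
  proof (rule continuous_map_into_topology_base[OF open_S])
    show "h ` A \<in> topspace (ZR_topology S (h ` K))" if "A \<in> topspace (ZR_topology R K)" for A
      using that ZR_image top by auto
    fix U assume "U \<in> ZR_base S (h ` K)"
    then obtain ys where ys: "set ys \<subseteq> even_part S" "U = {B \<in> ZR S (h ` K). set ys \<subseteq> B}"
      unfolding base_S by auto
    then have "ys \<in> lists (h ` even_part R)" by (auto simp: even_image)
    then obtain xs where xs: "set xs \<subseteq> even_part R" "ys = map h xs"
      by (auto simp: lists_image)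
    have "set ys \<subseteq> h ` A \<longleftrightarrow> set xs \<subseteq> A" if "A \<in> ZR R K" for A
    proof -
      have "set ys \<subseteq> h ` A \<longleftrightarrow> set xs \<subseteq> preimage (h ` A)"
        using xs R.even_part_subset by (auto simp: preimage_def)
      then show ?thesis using ZR_image(2)[OF that] by simp
    qed
    then have "{A \<in> topspace (ZR_topology R K). h ` A \<in> U} = {A \<in> ZR R K. set xs \<subseteq> A}"
      using ys(2) ZR_image(1) by (auto simp: top)
    also have "\<dots> \<in> ZR_base R K" unfolding base_R using xs(1) by blast
    finally show "openin (ZR_topology R K) {A \<in> topspace (ZR_topology R K). h ` A \<in> U}"
      by (rule open_baseI[OF open_R])
  qed
  moreover have "continuous_map (ZR_topology S (h ` K)) (ZR_topology R K) preimage"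
  proof (rule continuous_map_into_topology_base[OF open_R])
    show "preimage B \<in> topspace (ZR_topology R K)"
      if "B \<in> topspace (ZR_topology S (h ` K))" for B
      using that preimage_ZR[OF K] top by auto
    fix U assume "U \<in> ZR_base R K"
    then obtain xs where xs: "set xs \<subseteq> even_part R" "U = {A \<in> ZR R K. set xs \<subseteq> A}"
      unfolding base_R by auto
    have "set xs \<subseteq> preimage B \<longleftrightarrow> set (map h xs) \<subseteq> B" for B
      using xs(1) R.even_part_subset by (auto simp: preimage_def)
    then have "{B \<in> topspace (ZR_topology S (h ` K)). preimage B \<in> U}
        = {B \<in> ZR S (h ` K). set (map h xs) \<subseteq> B}"
      using xs(2) preimage_ZR[OF K] by (auto simp: top)
    also have "\<dots> \<in> ZR_base S (h ` K)"
      unfolding base_S using xs(1) even_image by (fastforce intro!: exI[of _ "map h xs"])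
    finally show "openin (ZR_topology S (h ` K))
        {B \<in> topspace (ZR_topology S (h ` K)). preimage B \<in> U}"
      by (rule open_baseI[OF open_S])
  qed
  ultimately show ?thesis
    using ZR_image image_preimage ZR_subset_carrier unfolding homeomorphic_maps_def top by auto
qed

end


section \<open>The superreduced ring\<close>

lemma superring_of_ring_simps [simp]:
  "carrier (superring_of_ring S) = carrier S"
  "mult (superring_of_ring S) = mult S"
  "one (superring_of_ring S) = one S"
  "zero (superring_of_ring S) = zero S"
  "add (superring_of_ring S) = add S"
  "even_part (superring_of_ring S) = carrier S"
  "odd_part (superring_of_ring S) = {\<zero>\<^bsub>S\<^esub>}"
  by (simp_all add: superring_of_ring_def ring.defs superring.defs)

lemma ring_superring_of_ring:
  assumes "ring S"
  shows "ring (superring_of_ring S)"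
proof -
  interpret ring S by fact
  show ?thesis
  proof (rule ringI)
    show "abelian_group (superring_of_ring S)"
    proof (rule abelian_groupI)
      fix x assume "x \<in> carrier (superring_of_ring S)"
      then show "\<exists>y\<in>carrier (superring_of_ring S).
          y \<oplus>\<^bsub>superring_of_ring S\<^esub> x = \<zero>\<^bsub>superring_of_ring S\<^esub>"
        by (auto intro!: bexI[of _ "\<ominus>\<^bsub>S\<^esub> x"] simp: l_neg)
    qed (auto simp: a_ac)
    show "Group.monoid (superring_of_ring S)"
      by (rule monoidI) (auto simp: m_assoc)
  qed (auto simp: l_distr r_distr)
qed

lemma superring_superring_of_ring:
  assumes "cring S" "\<one>\<^bsub>S\<^esub> \<noteq> \<zero>\<^bsub>S\<^esub>"
  shows "superring (superring_of_ring S)"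
proof -
  interpret cring S by fact
  interpret T: ring "superring_of_ring S"
    by (rule ring_superring_of_ring) (rule ring_axioms)
  have zero: "{\<zero>\<^bsub>S\<^esub>} = {\<zero>\<^bsub>superring_of_ring S\<^esub>}" by simp
  have "additive_subgroup (carrier (superring_of_ring S)) (superring_of_ring S)"
    "additive_subgroup {\<zero>\<^bsub>superring_of_ring S\<^esub>} (superring_of_ring S)"
    using T.oneideal T.zeroideal by (auto simp only: ideal_def)
  then have "additive_subgroup (even_part (superring_of_ring S)) (superring_of_ring S)"
    "additive_subgroup (odd_part (superring_of_ring S)) (superring_of_ring S)"
    by simp_all
  then show ?thesis
    using assms(2)
    by (intro superring.intro superring_axioms.intro T.ring_axioms)
      (auto simp: set_add_def' m_comm)
qed

theorem proposition5p3:
  fixes L :: "('a, 'm) superring_scheme" and K :: "'a set"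
  assumes "superfield L"
    and "subsuperring K L"
  shows "ZR_topology L K homeomorphic_space
    ZR_topology (superreduced L) (superreduced_image L K)"
proof -
  interpret L: superring L using assms(1) by (simp add: superfield_def)
  interpret F: field "L Quot odd_ideal L" using assms(1) by (simp add: superfield_def)
  interpret J: ideal "odd_ideal L" L by (rule L.ideal_odd_ideal)
  let ?h = "(+>\<^bsub>L\<^esub>) (odd_ideal L)"
  have hom: "?h \<in> ring_hom L (superreduced L)"
    using J.rcos_ring_hom by (simp add: ring_hom_def superreduced_def)
  have S: "superring (superreduced L)"
    unfolding superreduced_def
    by (rule superring_superring_of_ring) (rule F.cring_axioms, rule F.one_not_zero)
  have surj: "?h ` carrier L = carrier (superreduced L)"
    by (auto simp: superreduced_def FactRing_simps)
  have kernel: "x \<in> odd_ideal L" if "x \<in> carrier L" "?h x = \<zero>\<^bsub>superreduced L\<^esub>" for x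
    using that J.a_rcos_self[of x] by (simp add: superreduced_def FactRing_def)
  have "?h x \<in> ?h ` even_part L" if x: "x \<in> carrier L" for x
  proof -
    obtain a b where ab: "a \<in> even_part L" "b \<in> odd_part L" "x = a \<oplus>\<^bsub>L\<^esub> b"
      using L.even_odd_decomposition[OF x] .
    have carr: "a \<in> carrier L" "b \<in> carrier L"
      using ab L.even_part_subset L.odd_part_subset by auto
    have "b \<in> odd_ideal L" using ab L.odd_part_subset_odd_ideal by auto
    moreover have "x \<ominus>\<^bsub>L\<^esub> a = b"
      using carr ab(3) by (simp add: L.minus_eq L.a_comm[of _ "\<ominus>\<^bsub>L\<^esub> a"] L.r_neg1)
    ultimately have "x \<ominus>\<^bsub>L\<^esub> a \<in> odd_ideal L" by simp
    then have "?h x = ?h a"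
      using L.quotient_eq_iff_same_a_r_cos[OF L.ideal_odd_ideal x carr(1)] by simp
    then show ?thesis using ab(1) by auto
  qed
  then have "?h ` even_part L = ?h ` carrier L" using L.even_part_subset by auto
  then have even: "?h ` even_part L = even_part (superreduced L)"
    using surj by (simp add: superreduced_def)
  interpret S: superring "superreduced L" by (rule S)
  interpret Q: superring_odd_quotient L "superreduced L" ?h
    by unfold_locales (use hom surj even kernel in auto)
  have "K \<subseteq> carrier L"
    using assms(2) by (auto simp: subsuperring_def dest: subringE(1))
  then show ?thesis
    using Q.ZR_homeomorphic_maps unfolding homeomorphic_space_def superreduced_image_def by blast
qed

end
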